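(* Let $X$ be a real Banach space and let $\phi\in\mathscr{L}(X)$ with $\phi\notin \mathrm{span}\{I\}$ be such that $X$ is a $\phi$-space. Let $M$ be a nonempty, closed, convex and bounded subset of $X$. If $T:M\to M$ is a ws $\phi$-condensing mapping (that is, $T$ is weakly sequentially continuous and $\phi$-condensing), then there is a $y\in M$ such that $T(y)=y$.
   Context: $\mathscr{L}(X)$ denotes the bounded linear operators $X\to X$, $I$ is the identity of $X$, and $\mathrm{span}\{I\}$ is the vector space of scalar multiples of $I$. $\phi$-space: for $\phi\in\mathscr{L}(X)$ with $\phi\notin\mathrm{span}\{I\}$, $X$ is called a $\phi$-space if for every bounded and weakly closed subset $C$ of $X$ such that $\phi(C)$ is relatively compact (in norm), $C$ is weakly compact. For a nonempty bounded set $C\subset X$, the Kuratowski measure of noncompactness $\chi(C)$ is the infimum of all $\varepsilon>0$ such that $C$ can be covered by finitely many sets of diameter $\le\varepsilon$; set $\chi_\phi(C)=\chi(\phi(C))$. A map $T:M\to M$ is weakly sequentially continuous if $x_n\rightharpoonup x$ weakly with $x_n,x\in M$ implies $Tx_n\rightharpoonup Tx$ weakly. It is $\phi$-condensing if $\chi_\phi(T(C))<\chi_\phi(C)$ for every nonempty bounded $C\subset M$ with $\chi_\phi(C)>0$. *)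

theory Defs
  imports "HOL-Analysis.Analysis"
begin

definition weak_topology :: "'a::real_normed_vector topology" where
  "weak_topology = topology_generated_by
     {blinfun_apply f -` U | (f :: 'a \<Rightarrow>\<^sub>L real) U. open U}"

definition phi_space :: "('a::real_normed_vector \<Rightarrow>\<^sub>L 'a) \<Rightarrow> bool" where
  "phi_space \<phi> \<longleftrightarrow>
     (\<forall>C. bounded C \<and> closedin weak_topology C \<and> compact (closure (blinfun_apply \<phi> ` C))
          \<longrightarrow> compactin weak_topology C)"

(* The library's diameter is unspecified on unbounded sets, so boundedness of the
   covering sets is required separately; it is implied by having a finite diameter. *)
definition kuratowski_mnc :: "'a::metric_space set \<Rightarrow> real" where
  "kuratowski_mnc C =
     Inf {\<epsilon>. 0 < \<epsilon> \<and> (\<exists>\<F>. finite \<F> \<and> C \<subseteq> \<Union>\<F> \<and> (\<forall>S\<in>\<F>. bounded S \<and> diameter S \<le> \<epsilon>))}"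

definition phi_mnc :: "('a::real_normed_vector \<Rightarrow>\<^sub>L 'a) \<Rightarrow> 'a set \<Rightarrow> real" where
  "phi_mnc \<phi> C = kuratowski_mnc (blinfun_apply \<phi> ` C)"

definition weakly_seq_continuous_on :: "'a::real_normed_vector set \<Rightarrow> ('a \<Rightarrow> 'a) \<Rightarrow> bool" where
  "weakly_seq_continuous_on M T \<longleftrightarrow>
     (\<forall>x l. (\<forall>n. x n \<in> M) \<and> l \<in> M \<and> limitin weak_topology x l sequentially
          \<longrightarrow> limitin weak_topology (\<lambda>n. T (x n)) (T l) sequentially)"

definition phi_condensing_on ::
    "('a::real_normed_vector \<Rightarrow>\<^sub>L 'a) \<Rightarrow> 'a set \<Rightarrow> ('a \<Rightarrow> 'a) \<Rightarrow> bool" where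
  "phi_condensing_on \<phi> M T \<longleftrightarrow>
     (\<forall>C. C \<noteq> {} \<and> bounded C \<and> C \<subseteq> M \<and> 0 < phi_mnc \<phi> C
          \<longrightarrow> phi_mnc \<phi> (T ` C) < phi_mnc \<phi> C)"

end

theory Submission
  imports Defs
begin

text \<open>
  Fix a point \<open>x\<^sub>0\<close> of \<open>M\<close> and let \<open>K\<close> be the smallest closed convex \<open>T\<close>-invariant subset of \<open>M\<close>
  that contains it.  Minimality makes \<open>K\<close> the closed convex hull of \<open>T(K)\<close> and \<open>x\<^sub>0\<close>.  Since closed
  convex hulls do not increase the Kuratowski measure
  (\<open>kuratowski_mnc_closure_convex_hull_le\<close>) and bounded linear maps carry closed convex hulls into
  closed convex hulls, \<open>T(K)\<close> has at least the \<open>\<phi>\<close>-measure of \<open>K\<close>.  As \<open>T\<close> is condensing, this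
  measure is zero, so \<open>\<phi>(K)\<close> is relatively compact.  By Mazur's theorem (\<open>mazur_closed_convex\<close>)
  \<open>K\<close> is weakly closed, and the defining property of a \<open>\<phi>\<close>-space makes it weakly compact.

  It remains to find a fixed point of a weakly sequentially continuous self-map of a weakly compact
  convex set.  Here \<open>K\<close> can be replaced by a separable invariant subset
  (\<open>separable_invariant_convex_subset\<close>).  On such a set countably many functionals \<open>f k\<close> separate
  points, and therefore every sequence has a weakly convergent subsequence
  (\<open>weakly_convergent_subsequence\<close>); this takes the place of the theorem of Eberlein and Smulian.
  The argument of Schauder gives points \<open>x n\<close> at which the first \<open>n\<close> functionals move by at most
  \<open>1/(n+1)\<close> under \<open>T\<close> (\<open>weakly_approximate_fixed_point\<close>), and a weak limit of a subsequence of them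
  is fixed by \<open>T\<close>, because \<open>T\<close> preserves weak limits of sequences.

  Two classical theorems underlie this.  The theorem of Hahn and Banach is proved by observing that
  a minimal sublinear functional is linear; it yields the separation theorem behind Mazur's theorem
  without any extension of functionals from subspaces.  Brouwer's theorem is needed for cubes whose
  dimension is the size of a finite net, a number that arises inside the proof; it is therefore
  derived from Kuhn's combinatorial lemma for points with coordinates indexed by natural numbers.
\<close>

section \<open>Hahn--Banach and separation from a closed convex set\<close>

definition sublinear :: "('a::real_vector \<Rightarrow> real) \<Rightarrow> bool" where
  "sublinear p \<longleftrightarrow>
     (\<forall>x y. p (x + y) \<le> p x + p y) \<and> (\<forall>t\<ge>0. \<forall>x. p (t *\<^sub>R x) \<le> t * p x)"

lemma sublinearD:
  assumes "sublinear p"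
  shows "p (x + y) \<le> p x + p y"
    and "0 \<le> t \<Longrightarrow> p (t *\<^sub>R x) = t * p x"
    and "p 0 = 0"
    and "- p (- x) \<le> p x"
proof -
  have add: "p (x + y) \<le> p x + p y" for x y
    using assms by (auto simp: sublinear_def)
  have sc: "0 \<le> t \<Longrightarrow> p (t *\<^sub>R x) \<le> t * p x" for t x
    using assms by (auto simp: sublinear_def)
  show "p (x + y) \<le> p x + p y" by (rule add)
  show z: "p 0 = 0"
    using add[of 0 0] sc[of 0 0] by simp
  show "p (t *\<^sub>R x) = t * p x" if t: "0 \<le> t"
  proof (cases "t = 0")
    case True
    then show ?thesis by (simp add: z)
  next
    case False
    then have "p (inverse t *\<^sub>R (t *\<^sub>R x)) \<le> inverse t * p (t *\<^sub>R x)"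
      using t by (intro sc) auto
    then have "t * p x \<le> p (t *\<^sub>R x)"
      using t False by (simp add: field_simps)
    then show ?thesis
      using sc[OF t, of x] by simp
  qed
  show "- p (- x) \<le> p x"
    using add[of x "- x"] z by simp
qed

text \<open>
  All sublinear functionals below arise as infima of families; what makes such an infimum
  subadditive is that two members can be merged into a third one.
\<close>

lemma sublinear_INF:
  fixes h :: "'i \<Rightarrow> 'a::real_vector \<Rightarrow> real"
  assumes ne: "I \<noteq> {}"
    and low: "\<And>i x. i \<in> I \<Longrightarrow> L x \<le> h i x"
    and add: "\<And>i j x y. i \<in> I \<Longrightarrow> j \<in> I \<Longrightarrow> \<exists>k\<in>I. h k (x + y) \<le> h i x + h j y"
    and scale: "\<And>i t x. i \<in> I \<Longrightarrow> 0 \<le> t \<Longrightarrow> \<exists>k\<in>I. h k (t *\<^sub>R x) \<le> t * h i x"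
  shows "sublinear (\<lambda>x. INF i\<in>I. h i x)"
    and "\<And>i x. i \<in> I \<Longrightarrow> (INF i\<in>I. h i x) \<le> h i x"
proof -
  have bdd: "bdd_below ((\<lambda>i. h i x) ` I)" for x
    using low by (auto intro!: bdd_belowI2)
  show le: "(INF i\<in>I. h i x) \<le> h i x" if "i \<in> I" for i x
    using bdd that by (rule cINF_lower)
  let ?p = "\<lambda>x. INF i\<in>I. h i x"
  have p_add: "?p (x + y) \<le> ?p x + ?p y" for x y
  proof -
    have "?p (x + y) - h i x \<le> ?p y" if i: "i \<in> I" for i
    proof (rule cINF_greatest[OF ne])
      fix j assume "j \<in> I"
      then obtain k where "k \<in> I" "h k (x + y) \<le> h i x + h j y"
        using add i by blast
      then show "?p (x + y) - h i x \<le> h j y"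
        using le[of k "x + y"] by simp
    qed
    then have "?p (x + y) - ?p y \<le> ?p x"
      by (intro cINF_greatest[OF ne]) (simp add: algebra_simps)
    then show ?thesis by simp
  qed
  have p_scale: "?p (t *\<^sub>R x) \<le> t * ?p x" if t: "0 \<le> t" for t x
  proof -
    have *: "?p (t *\<^sub>R x) \<le> t * h i x" if "i \<in> I" for i
      using scale[OF that t, of x] le by (meson order_trans)
    show ?thesis
    proof (cases "t = 0")
      case True
      then show ?thesis
        using * ne by auto
    next
      case False
      then have "?p (t *\<^sub>R x) / t \<le> ?p x"
        using * t by (intro cINF_greatest[OF ne]) (simp add: field_simps)
      then show ?thesis
        using t False by (simp add: field_simps)
    qed
  qed
  show "sublinear ?p"
    using p_add p_scale by (auto simp: sublinear_def)
qed

text \<open>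
  For a direction \<open>a\<close>, the infimum over \<open>t \<ge> 0\<close> of \<open>q (x + t a) - t q(a)\<close> is again sublinear
  and lies below \<open>q\<close>.  If \<open>q\<close> is minimal, the two agree; the term \<open>t = 1\<close> then gives
  \<open>q x + q a \<le> q (x + a)\<close>.
\<close>

lemma minimal_sublinear_is_linear:
  fixes q :: "'a::real_vector \<Rightarrow> real"
  assumes q: "sublinear q"
    and min: "\<And>r. sublinear r \<Longrightarrow> r \<le> q \<Longrightarrow> r = q"
  shows "linear q"
proof -
  note D = sublinearD[OF q]
  have add: "q (x + a) = q x + q a" for x a
  proof -
    define h where "h t x = q (x + t *\<^sub>R a) - t * q a" for t x
    have low: "- q (- x) \<le> h t x" if "t \<in> {0..}" for t x
      using D(1)[of "x + t *\<^sub>R a" "- x"] D(2)[of t a] that by (simp add: h_def)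
    have h_add: "\<exists>k\<in>{0..}. h k (x + y) \<le> h s x + h t y" if "s \<in> {0..}" "t \<in> {0..}" for s t x y
      using that D(1)[of "x + s *\<^sub>R a" "y + t *\<^sub>R a"]
      by (intro bexI[of _ "s + t"]) (auto simp: h_def algebra_simps)
    have h_scale: "\<exists>k\<in>{0..}. h k (c *\<^sub>R x) \<le> c * h t x" if "t \<in> {0..}" "0 \<le> c" for c t x
      using that D(2)[of c "x + t *\<^sub>R a"]
      by (intro bexI[of _ "c * t"]) (auto simp: h_def algebra_simps)
    have ne: "{0::real..} \<noteq> {}" by auto
    note rule = sublinear_INF[of "{0..}" "\<lambda>x. - q (- x)" h]
    have sub: "sublinear (\<lambda>x. INF t\<in>{0..}. h t x)"
      by (rule rule(1), fact ne, erule low, erule (1) h_add, erule (1) h_scale)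
    have le: "(INF t\<in>{0..}. h t x) \<le> h t x" if t: "t \<in> {0..}" for t x
      by (rule rule(2), fact ne, erule low, erule (1) h_add, erule (1) h_scale, fact t)
    have "(\<lambda>x. INF t\<in>{0..}. h t x) = q"
    proof (rule min)
      show "(\<lambda>x. INF t\<in>{0..}. h t x) \<le> q"
        using le[of 0] by (auto simp: le_fun_def h_def)
    qed (fact sub)
    then have "q x \<le> h 1 x"
      using le[of 1 x] by (metis atLeast_iff zero_le_one)
    then show ?thesis
      using D(1)[of x a] by (simp add: h_def)
  qed
  have neg: "q (- x) = - q x" for x
    using add[of x "- x"] D(3) by simp
  have "q (t *\<^sub>R x) = t * q x" for t x
  proof (cases "0 \<le> t")
    case False
    then have "q ((- t) *\<^sub>R x) = (- t) * q x"
      by (intro D(2)) simp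
    then show ?thesis
      using neg[of "t *\<^sub>R x"] by simp
  qed (rule D(2))
  with add show ?thesis
    by (intro linearI) auto
qed

theorem hahn_banach_sublinear:
  fixes p :: "'a::real_vector \<Rightarrow> real"
  assumes p: "sublinear p"
  obtains f where "linear f" "f \<le> p"
proof -
  let ?A = "{q. sublinear q \<and> q \<le> p}"
  have "\<exists>m\<in>?A. \<forall>a\<in>?A. m \<ge> a \<longrightarrow> a = m"
  proof (rule predicate_Zorn)
    show "partial_order_on ?A (relation_of (\<ge>) ?A)"
      by (rule partial_order_on_relation_ofI) auto
    fix C assume C: "C \<in> Chains (relation_of (\<ge>) ?A)"
    then have CA: "C \<subseteq> ?A" and comp: "\<And>q r. q \<in> C \<Longrightarrow> r \<in> C \<Longrightarrow> q \<le> r \<or> r \<le> q"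
      by (auto simp: Chains_def relation_of_def)
    show "\<exists>u\<in>?A. \<forall>a\<in>C. u \<le> a"
    proof (cases "C = {}")
      case True
      then show ?thesis using p by auto
    next
      case False
      have low: "- p (- x) \<le> q x" if "q \<in> C" for q x
        using CA that sublinearD(4)[of q x] le_funD[of q p "- x"] by fastforce
      have add: "\<exists>k\<in>C. k (x + y) \<le> q x + r y" if qr: "q \<in> C" "r \<in> C" for q r x y
      proof -
        obtain k where "k \<in> C" "k \<le> q" "k \<le> r"
          using comp[OF qr] qr by blast
        moreover have "k (x + y) \<le> k x + k y"
          using CA \<open>k \<in> C\<close> by (auto intro: sublinearD)
        ultimately show ?thesis
          by (smt (verit) le_funD)
      qed
      have scale: "\<exists>k\<in>C. k (t *\<^sub>R x) \<le> t * q x" if "q \<in> C" "0 \<le> t" for q t x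
        using CA that sublinearD(2)[of q t x] by (intro bexI[of _ q]) auto
      note rule = sublinear_INF[of C "\<lambda>x. - p (- x)" "\<lambda>q. q"]
      have sub: "sublinear (\<lambda>x. INF q\<in>C. q x)"
        by (rule rule(1), fact False, erule low, erule (1) add, erule (1) scale)
      have le: "(INF q\<in>C. q x) \<le> q x" if q: "q \<in> C" for q x
        by (rule rule(2), fact False, erule low, erule (1) add, erule (1) scale, fact q)
      obtain q where "q \<in> C" "q \<le> p"
        using False CA by auto
      then have "(\<lambda>x. INF q\<in>C. q x) \<le> p"
        using le[OF \<open>q \<in> C\<close>] by (auto simp: le_fun_def intro: order_trans)
      then show ?thesis
        using sub le by (intro bexI[of _ "\<lambda>x. INF q\<in>C. q x"]) (auto simp: le_fun_def)
    qed
  qed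
  then obtain m where m: "sublinear m" "m \<le> p"
    and min: "\<And>a. sublinear a \<Longrightarrow> a \<le> p \<Longrightarrow> a \<le> m \<Longrightarrow> a = m"
    by blast
  have "linear m"
  proof (rule minimal_sublinear_is_linear[OF m(1)])
    fix r assume "sublinear r" "r \<le> m"
    then show "r = m"
      using min order_trans[OF _ m(2)] by metis
  qed
  with m show ?thesis using that by blast
qed

lemma convex_scaleR_sum:
  assumes "convex A" "a \<in> A" "a' \<in> A" "0 \<le> \<alpha>" "0 \<le> \<beta>"
  obtains c where "c \<in> A" "\<alpha> *\<^sub>R a + \<beta> *\<^sub>R a' = (\<alpha> + \<beta>) *\<^sub>R c"
proof (cases "\<alpha> + \<beta> = 0")
  case True
  then have "\<alpha> = 0" "\<beta> = 0" using assms by auto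
  then show ?thesis using that[of a] assms by simp
next
  case False
  then have "(\<alpha> / (\<alpha> + \<beta>)) *\<^sub>R a + (\<beta> / (\<alpha> + \<beta>)) *\<^sub>R a' \<in> A"
    using assms by (intro convexD) (auto simp: add_divide_distrib[symmetric])
  then show ?thesis
    using that False by (auto simp: scaleR_add_right)
qed

text \<open>
  The functional \<open>p y\<close>, the infimum of \<open>\<parallel>y + t e\<parallel> - t d\<close> over \<open>t \<ge> 0\<close> and \<open>e \<in> D\<close>, is sublinear
  because \<open>D\<close> is convex, and finite because \<open>\<parallel>e\<parallel> \<ge> d\<close>.  Any linear \<open>f \<le> p\<close> does the job:
  \<open>t = 0\<close> gives \<open>f y \<le> \<parallel>y\<parallel>\<close>, and \<open>t = 1\<close>, \<open>y = - e\<close> gives \<open>- f e \<le> - d\<close>.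
\<close>

lemma separate_convex_from_zero:
  fixes D :: "'a::real_normed_vector set"
  assumes conv: "convex D" and ne: "D \<noteq> {}" and d: "\<And>e. e \<in> D \<Longrightarrow> d \<le> norm e"
  obtains f :: "'a \<Rightarrow>\<^sub>L real" where "\<And>y. \<bar>f y\<bar> \<le> norm y" "\<And>e. e \<in> D \<Longrightarrow> d \<le> f e"
proof -
  let ?I = "{0::real..} \<times> D"
  define h :: "real \<times> 'a \<Rightarrow> 'a \<Rightarrow> real" where "h = (\<lambda>(t, e) y. norm (y + t *\<^sub>R e) - t * d)"
  obtain e0 where e0: "e0 \<in> D" using ne by auto
  then have "(0, e0) \<in> ?I" by simp
  then have neI: "?I \<noteq> {}" by blast
  have low: "- norm y \<le> h i y" if "i \<in> ?I" for i y
  proof -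
    obtain t e where i: "i = (t, e)" "0 \<le> t" "e \<in> D" using \<open>i \<in> ?I\<close> by auto
    have "t * d \<le> norm (t *\<^sub>R e)"
      using d[OF i(3)] i(2) by (simp add: mult_left_mono)
    moreover have "norm (t *\<^sub>R e) \<le> norm (y + t *\<^sub>R e) + norm y"
      using norm_triangle_ineq4[of "y + t *\<^sub>R e" y] by simp
    ultimately show ?thesis by (simp add: h_def i)
  qed
  have add: "\<exists>k\<in>?I. h k (x + y) \<le> h i x + h j y" if "i \<in> ?I" "j \<in> ?I" for i j x y
  proof -
    obtain s e t e' where i: "i = (s, e)" "0 \<le> s" "e \<in> D" and j: "j = (t, e')" "0 \<le> t" "e' \<in> D"
      using \<open>i \<in> ?I\<close> \<open>j \<in> ?I\<close> by auto
    obtain c where c: "c \<in> D" "s *\<^sub>R e + t *\<^sub>R e' = (s + t) *\<^sub>R c"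
      by (rule convex_scaleR_sum[OF conv i(3) j(3) i(2) j(2)])
    have "norm (x + y + (s + t) *\<^sub>R c) \<le> norm (x + s *\<^sub>R e) + norm (y + t *\<^sub>R e')"
      using norm_triangle_ineq[of "x + s *\<^sub>R e" "y + t *\<^sub>R e'"] c(2)
      by (simp add: algebra_simps)
    then have "h (s + t, c) (x + y) \<le> h i x + h j y"
      by (simp add: h_def i j algebra_simps)
    then show ?thesis
      using i j c by (intro bexI[of _ "(s + t, c)"]) auto
  qed
  have scale: "\<exists>k\<in>?I. h k (c *\<^sub>R x) \<le> c * h i x" if "i \<in> ?I" "0 \<le> c" for i c x
  proof -
    obtain t e where i: "i = (t, e)" "0 \<le> t" "e \<in> D" using \<open>i \<in> ?I\<close> by auto
    have "norm (c *\<^sub>R x + (c * t) *\<^sub>R e) = c * norm (x + t *\<^sub>R e)"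
      using \<open>0 \<le> c\<close> by (metis abs_of_nonneg norm_scaleR scaleR_add_right scaleR_scaleR)
    then have "h (c * t, e) (c *\<^sub>R x) \<le> c * h i x"
      by (simp add: h_def i algebra_simps)
    then show ?thesis
      using i \<open>0 \<le> c\<close> by (intro bexI[of _ "(c * t, e)"]) auto
  qed
  note rule = sublinear_INF[of ?I "\<lambda>y. - norm y" h]
  have sub: "sublinear (\<lambda>x. INF i\<in>?I. h i x)"
    by (rule rule(1), fact neI, erule low, erule (1) add, erule (1) scale)
  have INF_le: "(INF i\<in>?I. h i x) \<le> h i x" if i: "i \<in> ?I" for i x
    by (rule rule(2), fact neI, erule low, erule (1) add, erule (1) scale, fact i)
  obtain f where f: "linear f" "f \<le> (\<lambda>x. INF i\<in>?I. h i x)"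
    using hahn_banach_sublinear[OF sub] by blast
  have f_h: "f x \<le> h i x" if "i \<in> ?I" for i x
    using le_funD[OF f(2), of x] INF_le[OF that, of x] by linarith
  have le: "f y \<le> norm y" for y
    using f_h[of "(0, e0)" y] e0 by (simp add: h_def)
  have abs: "\<bar>f y\<bar> \<le> norm y" for y
    using le[of y] le[of "- y"] linear_neg[OF f(1), of y] by simp
  have "bounded_linear f"
    using abs f(1) by (intro bounded_linear_intro[where K = 1]) (auto simp: linear_add linear_scale)
  then have app: "blinfun_apply (Blinfun f) = f"
    by (rule bounded_linear_Blinfun_apply)
  show ?thesis
  proof (rule that[of "Blinfun f"])
    fix e assume "e \<in> D"
    then show "d \<le> Blinfun f e"
      using f_h[of "(1, e)" "- e"] linear_neg[OF f(1), of e] by (simp add: app h_def)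
  qed (use abs in \<open>simp add: app\<close>)
qed

corollary norming_functional:
  fixes x :: "'a::real_normed_vector"
  obtains f :: "'a \<Rightarrow>\<^sub>L real" where "\<And>y. \<bar>f y\<bar> \<le> norm y" "norm x \<le> f x"
  using separate_convex_from_zero[of "{x}" "norm x"] by auto

section \<open>The weak topology\<close>

lemma topspace_weak_topology [simp]: "topspace weak_topology = UNIV"
proof -
  have "UNIV \<in> {blinfun_apply f -` U | (f :: 'a \<Rightarrow>\<^sub>L real) U. open U}"
    by (rule CollectI, rule exI[of _ 0], rule exI[of _ UNIV]) auto
  then show ?thesis
    unfolding weak_topology_def topology_generated_by_topspace by blast
qed

lemma openin_weak_vimage:
  fixes f :: "'a::real_normed_vector \<Rightarrow>\<^sub>L real"
  assumes "open U"
  shows "openin weak_topology (blinfun_apply f -` U)"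
  unfolding weak_topology_def using assms by (intro topology_generated_by_Basis) blast

lemma continuous_map_weak_functional:
  fixes f :: "'a::real_normed_vector \<Rightarrow>\<^sub>L real"
  shows "continuous_map weak_topology euclidean (blinfun_apply f)"
  using openin_weak_vimage[of _ f] by (simp add: continuous_map_alt)

lemma limitin_weak_functional:
  fixes f :: "'a::real_normed_vector \<Rightarrow>\<^sub>L real"
  assumes "limitin weak_topology x l F"
  shows "((\<lambda>n. f (x n)) \<longlongrightarrow> f l) F"
  using continuous_map_limit[OF continuous_map_weak_functional assms, of f]
  by (simp add: o_def)

lemma tendsto_imp_limitin_weak:
  fixes x :: "'i \<Rightarrow> 'a::real_normed_vector"
  assumes "(x \<longlongrightarrow> l) F"
  shows "limitin weak_topology x l F"
proof -
  have "continuous_map euclidean weak_topology (\<lambda>x::'a. x)"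
    unfolding weak_topology_def
    by (rule continuous_on_generated_topo)
       (use topspace_weak_topology[where 'a='a] in
         \<open>auto simp: weak_topology_def intro!: open_vimage blinfun.continuous_on\<close>)
  from continuous_map_limit[OF this, of x l F] show ?thesis
    using assms by (simp add: o_def)
qed

text \<open>
  A point outside \<open>C\<close> has positive distance \<open>d\<close> from \<open>C\<close>, and a functional that is at least \<open>d\<close> on
  \<open>C - x\<close> defines a weakly open half-space around \<open>x\<close> that misses \<open>C\<close>.
\<close>

theorem mazur_closed_convex:
  fixes C :: "'a::real_normed_vector set"
  assumes "closed C" "convex C"
  shows "closedin weak_topology C"
proof (cases "C = {}")
  case False
  have "\<exists>V. openin weak_topology V \<and> x \<in> V \<and> V \<subseteq> - C" if x: "x \<notin> C" for x
  proof -
    obtain d where d: "0 < d" "\<And>c. c \<in> C \<Longrightarrow> d \<le> dist x c"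
      using assms(1) x unfolding closed_def open_contains_ball
      by (metis ComplD ComplI in_mono mem_ball not_le)
    let ?D = "(\<lambda>c. c - x) ` C"
    have "convex ?D"
      using convex_translation_subtract[OF assms(2), of x] .
    moreover have "d \<le> norm e" if "e \<in> ?D" for e
      using that d(2) by (auto simp: dist_norm norm_minus_commute)
    ultimately obtain f :: "'a \<Rightarrow>\<^sub>L real" where f: "\<And>e. e \<in> ?D \<Longrightarrow> d \<le> f e"
      using False separate_convex_from_zero[of ?D d] by (metis image_is_empty)
    have "f x + d \<le> f c" if "c \<in> C" for c
      using f[of "c - x"] that by (auto simp: blinfun.diff_right)
    then show ?thesis
      using d(1) openin_weak_vimage[of "{..< f x + d}" f]
      by (intro exI[of _ "blinfun_apply f -` {..< f x + d}"]) fastforce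
  qed
  then have "openin weak_topology (- C)"
    by (subst openin_subopen) blast
  then show ?thesis
    by (simp add: closedin_def Compl_eq_Diff_UNIV)
qed simp

lemma weak_limit_in_closed_convex:
  fixes C :: "'a::real_normed_vector set"
  assumes "closed C" "convex C" "limitin weak_topology x l sequentially" "\<And>n. x n \<in> C"
  shows "l \<in> C"
  using limitin_closedin[OF assms(3) mazur_closed_convex[OF assms(1,2)]] assms(4) by simp

section \<open>The Kuratowski measure of a closed convex hull\<close>

lemma bounded_diameter_le_iff:
  fixes S :: "'a::metric_space set"
  assumes "0 \<le> e"
  shows "bounded S \<and> diameter S \<le> e \<longleftrightarrow> (\<forall>x\<in>S. \<forall>y\<in>S. dist x y \<le> e)"
proof safe
  assume *: "\<forall>x\<in>S. \<forall>y\<in>S. dist x y \<le> e"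
  show "bounded S"
    using * unfolding bounded_def by (cases "S = {}") blast+
  show "diameter S \<le> e"
    using * assms unfolding diameter_def by (auto intro!: cSUP_least)
next
  fix x y assume "bounded S" "diameter S \<le> e" "x \<in> S" "y \<in> S"
  then show "dist x y \<le> e"
    using diameter_bounded_bound[of S x y] by simp
qed

text \<open>
  Bounding pairwise distances instead of the diameter builds the boundedness of the covering sets
  into the condition.
\<close>

definition small_cover :: "real \<Rightarrow> 'a::metric_space set \<Rightarrow> bool" where
  "small_cover e C \<longleftrightarrow> (\<exists>\<F>. finite \<F> \<and> C \<subseteq> \<Union>\<F> \<and> (\<forall>S\<in>\<F>. \<forall>x\<in>S. \<forall>y\<in>S. dist x y \<le> e))"

lemma kuratowski_mnc_eq: "kuratowski_mnc C = Inf {e. 0 < e \<and> small_cover e C}"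
proof -
  have "(0 < e \<and> (\<exists>\<F>. finite \<F> \<and> C \<subseteq> \<Union>\<F> \<and> (\<forall>S\<in>\<F>. bounded S \<and> diameter S \<le> e)))
      \<longleftrightarrow> 0 < e \<and> small_cover e C" for e
    using bounded_diameter_le_iff[of e] unfolding small_cover_def by (cases "0 < e") auto
  then show ?thesis
    unfolding kuratowski_mnc_def by simp
qed

lemma small_cover_mono: "small_cover e C \<Longrightarrow> e \<le> e' \<Longrightarrow> B \<subseteq> C \<Longrightarrow> small_cover e' B"
  unfolding small_cover_def by (meson order_trans)

lemma kuratowski_mnc_le:
  assumes "0 < e" "small_cover e C"
  shows "kuratowski_mnc C \<le> e"
  unfolding kuratowski_mnc_eq using assms by (intro cInf_lower bdd_belowI[of _ 0]) auto

lemma bounded_imp_small_cover: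
  assumes "bounded C"
  obtains e where "0 < e" "small_cover e C"
proof -
  have "small_cover (\<bar>diameter C\<bar> + 1) C"
    unfolding small_cover_def using diameter_bounded_bound[OF assms]
    by (intro exI[of _ "{C}"]) fastforce
  then show ?thesis by (intro that) auto
qed

lemma kuratowski_mnc_less:
  assumes "bounded C" "kuratowski_mnc C < e"
  shows "small_cover e C"
proof -
  obtain e0 where "0 < e0" "small_cover e0 C"
    using bounded_imp_small_cover[OF assms(1)] .
  then have "{e. 0 < e \<and> small_cover e C} \<noteq> {}" by blast
  then obtain d where "small_cover d C" "d < e"
    using cInf_lessD[OF _ assms(2)[unfolded kuratowski_mnc_eq]] by blast
  then show ?thesis
    using small_cover_mono by (metis less_imp_le order_refl)
qed

lemma kuratowski_mnc_nonneg:
  assumes "bounded C"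
  shows "0 \<le> kuratowski_mnc C"
proof -
  obtain e0 where "0 < e0" "small_cover e0 C"
    using bounded_imp_small_cover[OF assms] .
  then show ?thesis
    unfolding kuratowski_mnc_eq by (intro cInf_greatest) auto
qed

text \<open>
  A choice of one point from each covering set is a finite net, so that the set is totally bounded.
\<close>

lemma kuratowski_mnc_zero_imp_compact_closure:
  fixes C :: "'a::complete_space set"
  assumes "bounded C" "kuratowski_mnc C \<le> 0"
  shows "compact (closure C)"
proof (rule compact_eq_totally_bounded[THEN iffD2], intro conjI allI impI)
  show "complete (closure C)"
    by (simp add: complete_eq_closed)
  fix e :: real assume e: "0 < e"
  then obtain \<F> where F: "finite \<F>" "C \<subseteq> \<Union>\<F>" "\<And>S x y. S \<in> \<F> \<Longrightarrow> x \<in> S \<Longrightarrow> y \<in> S \<Longrightarrow> dist x y \<le> e / 2"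
    using kuratowski_mnc_less[OF assms(1), of "e / 2"] assms(2) unfolding small_cover_def by fastforce
  define k where "k = (\<lambda>S. (SOME x. x \<in> S)) ` (\<F> - {{}})"
  have "C \<subseteq> (\<Union>x\<in>k. cball x (e / 2))"
  proof
    fix y assume "y \<in> C"
    then obtain S where S: "S \<in> \<F>" "y \<in> S" using F by auto
    then have "(SOME x. x \<in> S) \<in> S" by (metis someI)
    then show "y \<in> (\<Union>x\<in>k. cball x (e / 2))"
      using S F(3) by (auto simp: k_def)
  qed
  moreover have "closed (\<Union>x\<in>k. cball x (e / 2))"
    using F(1) by (intro closed_UN) (auto simp: k_def)
  ultimately have "closure C \<subseteq> (\<Union>x\<in>k. cball x (e / 2))"
    by (rule closure_minimal)
  also have "\<dots> \<subseteq> (\<Union>x\<in>k. ball x e)"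
    using e by auto
  finally show "\<exists>k. finite k \<and> closure C \<subseteq> (\<Union>x\<in>k. ball x e)"
    using F(1) by (intro exI[of _ k]) (auto simp: k_def)
qed

lemma small_cover_closure:
  assumes "small_cover e C"
  shows "small_cover e (closure C)"
proof -
  obtain \<F> where F: "finite \<F>" "C \<subseteq> \<Union>\<F>" "\<forall>S\<in>\<F>. \<forall>x\<in>S. \<forall>y\<in>S. dist x y \<le> e"
    using assms unfolding small_cover_def by blast
  have "closure C \<subseteq> \<Union>(closure ` \<F>)"
  proof (rule closure_minimal)
    show "C \<subseteq> \<Union>(closure ` \<F>)"
    proof
      fix x assume "x \<in> C"
      then obtain S where "S \<in> \<F>" "x \<in> S" using F(2) by blast
      then show "x \<in> \<Union>(closure ` \<F>)"
        using closure_subset[of S] by blast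
    qed
    show "closed (\<Union>(closure ` \<F>))"
      using F(1) by (intro closed_Union) auto
  qed
  moreover have "dist x y \<le> e" if S: "S \<in> \<F>" and xy: "x \<in> closure S" "y \<in> closure S" for S x y
  proof -
    have "closure S \<subseteq> cball a e" if "a \<in> S" for a
    proof (rule closure_minimal)
      show "S \<subseteq> cball a e"
        using F(3) S that by (simp add: subset_iff)
    qed simp
    then have "S \<subseteq> cball y e"
      using xy(2) by (simp add: subset_iff dist_commute)
    then have "closure S \<subseteq> cball y e"
      by (rule closure_minimal) simp
    then have "x \<in> cball y e"
      using xy(1) by (rule subsetD)
    then show ?thesis
      by (simp add: dist_commute)
  qed
  ultimately have "closure C \<subseteq> \<Union>(closure ` \<F>) \<and> (\<forall>S\<in>closure ` \<F>. \<forall>x\<in>S. \<forall>y\<in>S. dist x y \<le> e)"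
    by (simp)
  then show ?thesis
    unfolding small_cover_def using F(1) by (intro exI[of _ "closure ` \<F>"] conjI) simp_all
qed

lemma dist_le_convex_hull:
  fixes S :: "'a::real_normed_vector set"
  assumes S: "\<And>x y. x \<in> S \<Longrightarrow> y \<in> S \<Longrightarrow> dist x y \<le> e"
    and xy: "x \<in> convex hull S" "y \<in> convex hull S"
  shows "dist x y \<le> e"
proof -
  have "convex hull S \<subseteq> cball a e" if "a \<in> S" for a
    by (rule hull_minimal) (use S[OF that] in \<open>simp_all add: subset_iff\<close>)
  then have "S \<subseteq> cball y e"
    using xy(2) by (simp add: subset_iff dist_commute)
  then have "convex hull S \<subseteq> cball y e"
    by (rule hull_minimal) simp
  then have "x \<in> cball y e"
    using xy(1) by (rule subsetD)
  then show ?thesis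
    by (simp add: dist_commute)
qed

lemma convex_hull_Un_segments:
  assumes "convex A" "convex B" "A \<noteq> {}" "B \<noteq> {}" and z: "z \<in> convex hull (A \<union> B)"
  obtains a b t where "a \<in> A" "b \<in> B" "0 \<le> t" "t \<le> 1" "z = (1 - t) *\<^sub>R a + t *\<^sub>R b"
proof -
  let ?J = "{(1 - t) *\<^sub>R a + t *\<^sub>R b | a b t. a \<in> A \<and> b \<in> B \<and> 0 \<le> t \<and> t \<le> (1::real)}"
  have "convex ?J"
  proof (rule convexI)
    fix x y :: 'a and u v :: real
    assume xy: "x \<in> ?J" "y \<in> ?J" and uv: "0 \<le> u" "0 \<le> v" "u + v = 1"
    obtain a b s where x: "a \<in> A" "b \<in> B" "0 \<le> s" "s \<le> 1" "x = (1 - s) *\<^sub>R a + s *\<^sub>R b"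
      using xy(1) by auto
    obtain a' b' t where y: "a' \<in> A" "b' \<in> B" "0 \<le> t" "t \<le> 1" "y = (1 - t) *\<^sub>R a' + t *\<^sub>R b'"
      using xy(2) by auto
    obtain c where c: "c \<in> A" "(u * (1 - s)) *\<^sub>R a + (v * (1 - t)) *\<^sub>R a' = (u * (1 - s) + v * (1 - t)) *\<^sub>R c"
      by (rule convex_scaleR_sum[OF assms(1) x(1) y(1), of "u * (1 - s)" "v * (1 - t)"])
         (use x y uv in auto)
    obtain d where d: "d \<in> B" "(u * s) *\<^sub>R b + (v * t) *\<^sub>R b' = (u * s + v * t) *\<^sub>R d"
      by (rule convex_scaleR_sum[OF assms(2) x(2) y(2), of "u * s" "v * t"])
         (use x y uv in auto)
    have e: "u * (1 - s) + v * (1 - t) = 1 - (u * s + v * t)"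
      using uv(3) by (simp add: algebra_simps)
    have "0 \<le> u * (1 - s) + v * (1 - t)" "0 \<le> u * s + v * t"
      using x y uv by auto
    moreover have "u *\<^sub>R x + v *\<^sub>R y
        = ((u * (1 - s)) *\<^sub>R a + (v * (1 - t)) *\<^sub>R a') + ((u * s) *\<^sub>R b + (v * t) *\<^sub>R b')"
      unfolding x(5) y(5) by (simp add: scaleR_add_right add.commute add.left_commute)
    then have "u *\<^sub>R x + v *\<^sub>R y = (1 - (u * s + v * t)) *\<^sub>R c + (u * s + v * t) *\<^sub>R d"
      using c(2) d(2) e by simp
    ultimately show "u *\<^sub>R x + v *\<^sub>R y \<in> ?J"
      using c(1) d(1) e by (intro CollectI exI[of _ c] exI[of _ d] exI[of _ "u * s + v * t"]) auto
  qed
  moreover have "A \<union> B \<subseteq> ?J"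
  proof -
    obtain a0 b0 where ab: "a0 \<in> A" "b0 \<in> B" using assms by auto
    have "x \<in> ?J" if "x \<in> A" for x
      using that ab by (intro CollectI exI[of _ x] exI[of _ b0] exI[of _ 0]) auto
    moreover have "x \<in> ?J" if "x \<in> B" for x
      using that ab by (intro CollectI exI[of _ a0] exI[of _ x] exI[of _ 1]) auto
    ultimately show ?thesis by blast
  qed
  ultimately have "z \<in> ?J"
    using z hull_minimal[of "A \<union> B" ?J convex] by blast
  then show ?thesis using that by blast
qed

text \<open>
  The convex hull of two convex sets consists of the points \<open>(1 - t) s + t h\<close>.  Rounding \<open>t\<close> to
  a finite grid moves such a point only a little, and for a fixed \<open>t\<close> the set of these points, with
  \<open>s\<close> and \<open>h\<close> confined to sets of diameter at most \<open>e\<close>, again has diameter at most \<open>e\<close>.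
\<close>

lemma small_cover_convex_hull_Un:
  fixes S H :: "'a::real_normed_vector set"
  assumes conv: "convex S" "convex H" and ne: "S \<noteq> {}" "H \<noteq> {}" and bd: "bounded S" "bounded H"
    and S: "\<And>x y. x \<in> S \<Longrightarrow> y \<in> S \<Longrightarrow> dist x y \<le> e" and H: "small_cover e H" and d: "0 < d"
  shows "small_cover (e + d) (convex hull (S \<union> H))"
proof -
  obtain \<G> where G: "finite \<G>" "H \<subseteq> \<Union>\<G>" "\<forall>D\<in>\<G>. \<forall>x\<in>D. \<forall>y\<in>D. dist x y \<le> e"
    using H unfolding small_cover_def by (elim exE conjE)
  obtain R where R: "\<And>x. x \<in> S \<union> H \<Longrightarrow> norm x \<le> R" "0 < R"
    using bd bounded_pos[of "S \<union> H"] by (metis bounded_Un)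
  (* rounding t to a multiple of 1/N moves a point by at most 2 R / N, which is to be at most d / 2 *)
  obtain N :: nat where N: "4 * R / d < real N"
    using reals_Archimedean2 by blast
  then have N0: "0 < real N"
    using R(2) d divide_pos_pos[of "4 * R" d] by linarith
  define W where "W D k = {z. \<exists>s\<in>S. \<exists>h\<in>D. dist z ((1 - real k / real N) *\<^sub>R s + (real k / real N) *\<^sub>R h) \<le> d / 2}"
    for D k
  let ?C = "(\<lambda>(D, k). W D k) ` (\<G> \<times> {..N})"
  have "convex hull (S \<union> H) \<subseteq> \<Union>?C"
  proof
    fix z assume "z \<in> convex hull (S \<union> H)"
    then obtain s h t where z: "s \<in> S" "h \<in> H" "0 \<le> t" "t \<le> 1" "z = (1 - t) *\<^sub>R s + t *\<^sub>R h"
      using convex_hull_Un_segments[OF conv ne] by blast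
    obtain D where D: "D \<in> \<G>" "h \<in> D" using G(2) z(2) by auto
    define k where "k = nat \<lfloor>t * real N\<rfloor>"
    have "real k \<le> t * real N" "t * real N < real k + 1"
      using z(3) N0 by (auto simp: k_def)
    then have k: "\<bar>t - real k / real N\<bar> \<le> 1 / real N" "k \<le> N"
    proof -
      show "k \<le> N"
        using \<open>real k \<le> t * real N\<close> z(4) N0 mult_right_mono[of t 1 "real N"] by linarith
      have "t - real k / real N = (t * real N - real k) / real N"
        using N0 by (simp add: field_simps)
      then show "\<bar>t - real k / real N\<bar> \<le> 1 / real N"
        using \<open>real k \<le> t * real N\<close> \<open>t * real N < real k + 1\<close> N0 by (simp add: divide_right_mono)
    qed
    have "z - ((1 - real k / real N) *\<^sub>R s + (real k / real N) *\<^sub>R h) = (t - real k / real N) *\<^sub>R (h - s)"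
      unfolding z(5) by (simp add: algebra_simps)
    then have "dist z ((1 - real k / real N) *\<^sub>R s + (real k / real N) *\<^sub>R h)
        = \<bar>t - real k / real N\<bar> * norm (h - s)"
      by (simp add: dist_norm)
    also have "\<dots> \<le> (1 / real N) * (2 * R)"
      using k(1) R(1)[of s] R(1)[of h] z norm_triangle_ineq4[of h s] by (intro mult_mono) auto
    also have "\<dots> \<le> d / 2"
      using N N0 d by (simp add: field_simps)
    finally have "z \<in> W D k"
      using z(1) D(2) by (auto simp: W_def)
    then show "z \<in> \<Union>?C"
      using D(1) k(2) by auto
  qed
  moreover have "dist x y \<le> e + d" if D: "D \<in> \<G>" and k: "k \<le> N" and xy: "x \<in> W D k" "y \<in> W D k"
    for D k x y
  proof -
    define t where "t = real k / real N"
    have t: "0 \<le> t" "t \<le> 1" using k N0 by (auto simp: t_def)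
    obtain s h where x: "s \<in> S" "h \<in> D" "dist x ((1 - t) *\<^sub>R s + t *\<^sub>R h) \<le> d / 2"
      using xy(1) by (auto simp: W_def t_def)
    obtain s' h' where y: "s' \<in> S" "h' \<in> D" "dist y ((1 - t) *\<^sub>R s' + t *\<^sub>R h') \<le> d / 2"
      using xy(2) by (auto simp: W_def t_def)
    have "((1 - t) *\<^sub>R s + t *\<^sub>R h) - ((1 - t) *\<^sub>R s' + t *\<^sub>R h') = (1 - t) *\<^sub>R (s - s') + t *\<^sub>R (h - h')"
      by (simp add: algebra_simps)
    then have "dist ((1 - t) *\<^sub>R s + t *\<^sub>R h) ((1 - t) *\<^sub>R s' + t *\<^sub>R h')
        \<le> (1 - t) * dist s s' + t * dist h h'"
      using t norm_triangle_ineq[of "(1 - t) *\<^sub>R (s - s')" "t *\<^sub>R (h - h')"] by (simp add: dist_norm)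
    also have "\<dots> \<le> (1 - t) * e + t * e"
      using S x y G(3) D t by (intro add_mono mult_left_mono) auto
    finally have m: "dist ((1 - t) *\<^sub>R s + t *\<^sub>R h) ((1 - t) *\<^sub>R s' + t *\<^sub>R h') \<le> e"
      by (simp add: algebra_simps)
    show ?thesis
      using x(3) y(3) m
        dist_triangle[of x y "(1 - t) *\<^sub>R s + t *\<^sub>R h"]
        dist_triangle[of "(1 - t) *\<^sub>R s + t *\<^sub>R h" y "(1 - t) *\<^sub>R s' + t *\<^sub>R h'"]
      by (simp add: dist_commute)
  qed
  ultimately show ?thesis
    unfolding small_cover_def using G(1) by (intro exI[of _ ?C]) auto
qed

text \<open>
  Adjoining the covering sets one at a time, each adjunction being granted half of the remaining
  tolerance.  The point \<open>p\<close> keeps the hull nonempty at the start of the induction.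
\<close>

lemma small_cover_convex_hull_Union:
  fixes p :: "'a::real_normed_vector"
  assumes "finite \<F>" and "\<And>S x y. S \<in> \<F> \<Longrightarrow> x \<in> S \<Longrightarrow> y \<in> S \<Longrightarrow> dist x y \<le> e"
    and "0 \<le> e" "0 < d"
  shows "small_cover (e + d) (convex hull (insert p (\<Union>\<F>)))"
  using assms(1,2,4)
proof (induction \<F> arbitrary: d rule: finite_induct)
  case empty
  then show ?case
    unfolding small_cover_def using \<open>0 \<le> e\<close> by (intro exI[of _ "{{p}}"]) auto
next
  case (insert S \<F>)
  let ?H = "convex hull (insert p (\<Union>\<F>))"
  have "small_cover (e + d / 2) ?H"
    using insert.prems by (intro insert.IH) auto
  show ?case
  proof (cases "S = {}")
    case True
    then show ?thesis
      using insert.prems by (intro small_cover_mono[OF \<open>small_cover (e + d / 2) ?H\<close>]) auto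
  next
    case False
    have bdS: "bounded T" if "T \<in> insert S \<F>" for T
      using insert.prems(1)[OF that] bounded_diameter_le_iff[OF \<open>0 \<le> e\<close>, of T] by blast
    have "dist x y \<le> e + d / 2" if "x \<in> convex hull S" "y \<in> convex hull S" for x y
    proof -
      have "dist x y \<le> e"
        using insert.prems(1) by (intro dist_le_convex_hull[OF _ that]) auto
      then show ?thesis using insert.prems(2) by simp
    qed
    then have "small_cover (e + d / 2 + d / 2) (convex hull (convex hull S \<union> ?H))"
      using False bdS insert.hyps(1) insert.prems(2) \<open>small_cover (e + d / 2) ?H\<close>
      by (intro small_cover_convex_hull_Un bounded_convex_hull bounded_insert[THEN iffD2] bounded_Union) auto
    moreover have "convex hull (insert p (\<Union>(insert S \<F>))) \<subseteq> convex hull (convex hull S \<union> ?H)"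
      by (intro hull_mono) (auto intro: hull_inc)
    ultimately show ?thesis
      using small_cover_mono[of "e + d / 2 + d / 2" _ "e + d"] by simp
  qed
qed

text \<open>
  The argument of Darbo: the hull of \<open>A\<close> lies in the hull of any finite cover of \<open>A\<close>, which can be
  covered by sets of almost the same size; the single point \<open>p\<close> is a covering set of diameter zero.
\<close>

theorem kuratowski_mnc_closure_convex_hull_le:
  fixes A :: "'a::real_normed_vector set"
  assumes A: "bounded A" and B: "B \<subseteq> closure (convex hull (insert p A))"
  shows "kuratowski_mnc B \<le> kuratowski_mnc A"
proof (rule field_le_epsilon)
  fix d :: real assume d: "0 < d"
  let ?e = "kuratowski_mnc A + d / 2"
  have e: "0 < ?e" using kuratowski_mnc_nonneg[OF A] d by simp
  have "small_cover ?e A"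
    using A d by (intro kuratowski_mnc_less) auto
  then obtain \<F> where F: "finite \<F>" "A \<subseteq> \<Union>\<F>" "\<forall>S\<in>\<F>. \<forall>x\<in>S. \<forall>y\<in>S. dist x y \<le> ?e"
    unfolding small_cover_def by (elim exE conjE)
  have "small_cover (?e + d / 2) (convex hull (insert p (\<Union>\<F>)))"
    using F(3) e d by (intro small_cover_convex_hull_Union F(1)) auto
  then have "small_cover (?e + d / 2) (closure (convex hull (insert p (\<Union>\<F>))))"
    by (rule small_cover_closure)
  moreover have "B \<subseteq> closure (convex hull (insert p (\<Union>\<F>)))"
    using B F(2) by (elim order_trans) (intro closure_mono hull_mono insert_mono)
  ultimately have "small_cover (?e + d / 2) B"
    by (rule small_cover_mono[OF _ order_refl])
  then have "kuratowski_mnc B \<le> ?e + d / 2"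
    using e d by (intro kuratowski_mnc_le) auto
  then show "kuratowski_mnc B \<le> kuratowski_mnc A + d" by simp
qed

section \<open>Brouwer's theorem for cubes of arbitrary dimension\<close>

lemma compact_PiE_interval: "compact (PiE UNIV (\<lambda>_::nat. {- B..B::real}))"
proof -
  have "compactin (product_topology (\<lambda>_::nat. euclidean :: real topology) UNIV) (PiE UNIV (\<lambda>_. {- B..B}))"
    by (simp add: compactin_PiE)
  then show ?thesis
    by (simp only: euclidean_product_topology compactin_euclidean_iff)
qed

lemma coordinatewise_convergent_subsequence:
  fixes x :: "nat \<Rightarrow> nat \<Rightarrow> real"
  assumes "\<And>m i. \<bar>x m i\<bar> \<le> B"
  obtains l r where "strict_mono r" "\<And>i. (\<lambda>m. x (r m) i) \<longlonglongrightarrow> l i"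
proof -
  let ?P = "PiE UNIV (\<lambda>_::nat. {- B..B})"
  have "\<forall>m. x m \<in> ?P"
    using assms by (simp add: PiE_UNIV_domain abs_le_iff minus_le_iff)
  then obtain l r where lr: "strict_mono r" "(x \<circ> r) \<longlonglongrightarrow> l"
    using compact_imp_seq_compact[OF compact_PiE_interval[of B]] unfolding seq_compact_def by blast
  have "isCont (\<lambda>f. f i) l" for i :: nat and l :: "nat \<Rightarrow> real"
    by (metis UNIV_I continuous_on_eq_continuous_at continuous_on_product_coordinates open_UNIV)
  then have "(\<lambda>m. x (r m) i) \<longlonglongrightarrow> l i" for i
    using isCont_tendsto_compose[OF _ lr(2), of "\<lambda>f. f i"] by simp
  then show ?thesis
    by (rule that[OF lr(1)])
qed

text \<open>
  Points of the \<open>n\<close>-cube are functions on the natural numbers of which only the first \<open>n\<close>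
  coordinates matter, so that \<open>n\<close> can vary.  Each grid point is labelled in coordinate \<open>i\<close> by the
  sign of \<open>G x i - x i\<close>, with the faces labelled as Kuhn's lemma requires.  That lemma yields, for
  every mesh \<open>1/p\<close>, a cell in which each coordinate carries both labels; as the mesh shrinks these
  cells accumulate at a fixed point.
\<close>

theorem brouwer_cube_nat:
  fixes G :: "(nat \<Rightarrow> real) \<Rightarrow> nat \<Rightarrow> real"
  assumes maps: "\<And>t i. (\<And>j. j < n \<Longrightarrow> 0 \<le> t j \<and> t j \<le> 1) \<Longrightarrow> i < n \<Longrightarrow> 0 \<le> G t i \<and> G t i \<le> 1"
    and cont: "\<And>u t i. (\<And>m j. j < n \<Longrightarrow> 0 \<le> u m j \<and> u m j \<le> 1) \<Longrightarrow>
        (\<And>j. j < n \<Longrightarrow> (\<lambda>m. u m j) \<longlonglongrightarrow> t j) \<Longrightarrow> i < n \<Longrightarrow>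
        (\<lambda>m. G (u m) i) \<longlonglongrightarrow> G t i"
  obtains t where "\<And>i. i < n \<Longrightarrow> 0 \<le> t i \<and> t i \<le> 1" "\<And>i. i < n \<Longrightarrow> G t i = t i"
proof -
  define grid where "grid p x = (\<lambda>j. real (x j) / real p)" for p :: nat and x :: "nat \<Rightarrow> nat"
  define label where
    "label p x i = (if x i = p \<or> (x i \<noteq> 0 \<and> G (grid p x) i < grid p x i) then 1 else (0::nat))"
    for p x i
  have grid01: "0 \<le> grid p x j \<and> grid p x j \<le> 1" if "x j \<le> p" for p x j
    using that by (cases "p = 0") (auto simp: grid_def)
  (* on the faces, where the label is prescribed, the inequality it stands for holds because G
     preserves the cube *)
  have label0: "grid p x i \<le> G (grid p x) i"
    if "\<And>j. j < n \<Longrightarrow> x j \<le> p" "i < n" "label p x i = 0" for p x i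
    using that maps[of "grid p x" i] grid01[of x _ p]
    by (auto simp: label_def grid_def split: if_splits)
  have label1: "G (grid p x) i \<le> grid p x i"
    if "\<And>j. j < n \<Longrightarrow> x j \<le> p" "i < n" "label p x i \<noteq> 0" "0 < p" for p x i
    using that maps[of "grid p x" i] grid01[of x _ p]
    by (auto simp: label_def grid_def split: if_splits)
  define near where "near x y \<longleftrightarrow> (\<forall>j<n. x j \<le> y j \<and> y j \<le> x j + 1)" for x y :: "nat \<Rightarrow> nat"
  have "\<exists>q. (\<forall>i<n. q i < Suc m) \<and>
      (\<forall>i<n. \<exists>r s. near q r \<and> near q s \<and> label (Suc m) r i = 0 \<and> label (Suc m) s i \<noteq> 0)" for m
  proof -
    obtain q where q: "\<forall>i<n. q i < Suc m"
      "\<forall>i<n. \<exists>r s. (\<forall>j<n. q j \<le> r j \<and> r j \<le> q j + 1) \<and> (\<forall>j<n. q j \<le> s j \<and> s j \<le> q j + 1) \<and>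
        label (Suc m) r i \<noteq> label (Suc m) s i"
      by (rule kuhn_lemma[of "Suc m" n "label (Suc m)"]) (auto simp: label_def)
    have two: "label p x i = 0 \<or> label p x i = 1" for p x i
      by (simp add: label_def)
    show ?thesis
    proof (rule exI[of _ q], intro conjI allI impI)
      fix i assume "i < n"
      then obtain r s where "near q r" "near q s" "label (Suc m) r i \<noteq> label (Suc m) s i"
        using q(2) unfolding near_def by blast
      then show "\<exists>r s. near q r \<and> near q s \<and> label (Suc m) r i = 0 \<and> label (Suc m) s i \<noteq> 0"
        using two[of "Suc m" r i] two[of "Suc m" s i] by (metis zero_neq_one)
    qed (use q in auto)
  qed
  then obtain q where q': "\<And>m. (\<forall>i<n. q m i < Suc m) \<and>
      (\<forall>i<n. \<exists>r s. near (q m) r \<and> near (q m) s \<and> label (Suc m) r i = 0 \<and> label (Suc m) s i \<noteq> 0)"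
    by metis
  then have q: "\<And>m i. i < n \<Longrightarrow> q m i < Suc m"
    and cell: "\<And>m i. i < n \<Longrightarrow> \<exists>r s. near (q m) r \<and> near (q m) s \<and>
      label (Suc m) r i = 0 \<and> label (Suc m) s i \<noteq> 0"
    by blast+
  have "\<bar>if j < n then grid (Suc m) (q m) j else 0\<bar> \<le> 1" for m j
    using grid01[of "q m" j "Suc m"] q[of j m] by auto
  then obtain t \<rho> where \<rho>: "strict_mono \<rho>"
    and lim: "\<And>j. (\<lambda>m. if j < n then grid (Suc (\<rho> m)) (q (\<rho> m)) j else 0) \<longlonglongrightarrow> t j"
    by (rule coordinatewise_convergent_subsequence[of "\<lambda>m j. if j < n then grid (Suc m) (q m) j else 0"]) blast
  have mesh: "(\<lambda>m. 1 / real (Suc (\<rho> m))) \<longlonglongrightarrow> 0"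
    using LIMSEQ_subseq_LIMSEQ[OF LIMSEQ_inverse_real_of_nat \<rho>] by (simp add: o_def inverse_eq_divide)
  have conv: "(\<lambda>m. grid (Suc (\<rho> m)) (v m) j) \<longlonglongrightarrow> t j"
    if near: "\<And>m. near (q (\<rho> m)) (v m)" and j: "j < n" for v j
  proof (rule tendsto_sandwich)
    have v: "q (\<rho> m) j \<le> v m j \<and> v m j \<le> q (\<rho> m) j + 1" for m
      using near[of m] j by (simp add: near_def)
    have l: "(\<lambda>m. grid (Suc (\<rho> m)) (q (\<rho> m)) j) \<longlonglongrightarrow> t j"
      using lim[of j] j by simp
    then show "(\<lambda>m. grid (Suc (\<rho> m)) (q (\<rho> m)) j) \<longlonglongrightarrow> t j" .
    show "(\<lambda>m. grid (Suc (\<rho> m)) (q (\<rho> m)) j + 1 / real (Suc (\<rho> m))) \<longlonglongrightarrow> t j"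
      using tendsto_add[OF l mesh] by simp
    show "\<forall>\<^sub>F m in sequentially. grid (Suc (\<rho> m)) (q (\<rho> m)) j \<le> grid (Suc (\<rho> m)) (v m) j"
      using v by (intro always_eventually allI) (simp add: grid_def divide_right_mono)
    have "real (v m j) \<le> real (q (\<rho> m) j) + 1" for m
      using v[of m] by linarith
    then have "grid (Suc (\<rho> m)) (v m) j \<le> grid (Suc (\<rho> m)) (q (\<rho> m)) j + 1 / real (Suc (\<rho> m))" for m
      unfolding grid_def add_divide_distrib[symmetric] by (intro divide_right_mono) auto
    then show "\<forall>\<^sub>F m in sequentially. grid (Suc (\<rho> m)) (v m) j
        \<le> grid (Suc (\<rho> m)) (q (\<rho> m)) j + 1 / real (Suc (\<rho> m))"
      by (intro always_eventually allI)
  qed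
  have vle: "v j \<le> Suc (\<rho> m)" if "near (q (\<rho> m)) v" "j < n" for v m j
    using that q[of j "\<rho> m"] by (fastforce simp: near_def)
  have "G t i = t i" if i: "i < n" for i
  proof -
    obtain r s where rs: "\<And>m. near (q m) (r m)" "\<And>m. near (q m) (s m)"
      "\<And>m. label (Suc m) (r m) i = 0" "\<And>m. label (Suc m) (s m) i \<noteq> 0"
      using cell[OF i] by metis
    define r' where "r' m = grid (Suc (\<rho> m)) (r (\<rho> m))" for m
    define s' where "s' m = grid (Suc (\<rho> m)) (s (\<rho> m))" for m
    have r: "(\<lambda>m. r' m j) \<longlonglongrightarrow> t j" "0 \<le> r' m j \<and> r' m j \<le> 1" if "j < n" for j m
      using conv[of "\<lambda>m. r (\<rho> m)" j] vle[of m "r (\<rho> m)" j] rs that grid01[of "r (\<rho> m)" j "Suc (\<rho> m)"]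
      by (auto simp: r'_def)
    have s: "(\<lambda>m. s' m j) \<longlonglongrightarrow> t j" "0 \<le> s' m j \<and> s' m j \<le> 1" if "j < n" for j m
      using conv[of "\<lambda>m. s (\<rho> m)" j] vle[of m "s (\<rho> m)" j] rs that grid01[of "s (\<rho> m)" j "Suc (\<rho> m)"]
      by (auto simp: s'_def)
    have "t i \<le> G t i"
    proof (rule LIMSEQ_le[OF r(1)[OF i] cont[OF r(2) r(1) i]])
      show "\<exists>N. \<forall>m\<ge>N. r' m i \<le> G (r' m) i"
        unfolding r'_def using rs vle i by (intro exI[of _ 0] allI impI label0) blast+
    qed auto
    moreover have "G t i \<le> t i"
    proof (rule LIMSEQ_le[OF cont[OF s(2) s(1) i] s(1)[OF i]])
      show "\<exists>N. \<forall>m\<ge>N. G (s' m) i \<le> s' m i"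
        unfolding s'_def using rs vle i by (intro exI[of _ 0] allI impI label1) auto
    qed auto
    ultimately show ?thesis by simp
  qed
  moreover have "0 \<le> t i \<and> t i \<le> 1" if "i < n" for i
  proof
    have l: "(\<lambda>m. grid (Suc (\<rho> m)) (q (\<rho> m)) i) \<longlonglongrightarrow> t i"
      using lim[of i] that by simp
    have b: "0 \<le> grid (Suc (\<rho> m)) (q (\<rho> m)) i \<and> grid (Suc (\<rho> m)) (q (\<rho> m)) i \<le> 1" for m
      using grid01[of "q (\<rho> m)" i "Suc (\<rho> m)"] q[OF that, of "\<rho> m"] by auto
    show "0 \<le> t i" using LIMSEQ_le_const[OF l, of 0] b by auto
    show "t i \<le> 1" using LIMSEQ_le_const2[OF l, of 1] b by auto
  qed
  ultimately show ?thesis using that by blast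
qed

section \<open>Weakly compact sets with a countable separating family of functionals\<close>

lemma compactin_cluster_point:
  assumes C: "compactin X C" and I: "infinite I" "\<And>m. m \<in> I \<Longrightarrow> x m \<in> C"
  obtains l where "l \<in> C" "\<And>U. openin X U \<Longrightarrow> l \<in> U \<Longrightarrow> infinite {m \<in> I. x m \<in> U}"
proof (rule ccontr)
  assume "\<not> thesis"
  then have "\<forall>l\<in>C. \<exists>U. openin X U \<and> l \<in> U \<and> finite {m \<in> I. x m \<in> U}"
    using that by blast
  then obtain U where U: "\<And>l. l \<in> C \<Longrightarrow> openin X (U l)" "\<And>l. l \<in> C \<Longrightarrow> l \<in> U l"
    "\<And>l. l \<in> C \<Longrightarrow> finite {m \<in> I. x m \<in> U l}"
    by metis
  have "(\<forall>V\<in>U ` C. openin X V) \<and> C \<subseteq> \<Union>(U ` C)"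
    using U(1,2) by blast
  then obtain \<F> where "finite \<F>" "\<F> \<subseteq> U ` C" "C \<subseteq> \<Union>\<F>"
    using C unfolding compactin_def by meson
  then obtain L where L: "finite L" "L \<subseteq> C" "C \<subseteq> \<Union>(U ` L)"
    by (metis finite_subset_image)
  have "I \<subseteq> (\<Union>l\<in>L. {m \<in> I. x m \<in> U l})"
    using I(2) L(3) by blast
  moreover have "finite (\<Union>l\<in>L. {m \<in> I. x m \<in> U l})"
    using L U(3) by blast
  ultimately show False
    using I(1) finite_subset by blast
qed

text \<open>
  After passage to a subsequence all \<open>f k (x m)\<close> converge.  Every weak cluster point then takes the
  limit values under the \<open>f k\<close>, and as these separate points there is only one cluster point.
\<close>

lemma weakly_convergent_subsequence:
  fixes f :: "nat \<Rightarrow> 'a::real_normed_vector \<Rightarrow>\<^sub>L real"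
  assumes K: "compactin weak_topology K" "bounded K"
    and f: "\<And>k y. \<bar>f k y\<bar> \<le> norm y"
    and sep: "\<And>y z. y \<in> K \<Longrightarrow> z \<in> K \<Longrightarrow> (\<And>k. f k y = f k z) \<Longrightarrow> y = z"
    and x: "\<And>m::nat. x m \<in> K"
  obtains l r where "l \<in> K" "strict_mono r" "limitin weak_topology (\<lambda>m. x (r m)) l sequentially"
proof -
  obtain B where B: "\<And>y. y \<in> K \<Longrightarrow> norm y \<le> B"
    using K(2) unfolding bounded_iff by blast
  have "\<bar>f k (x m)\<bar> \<le> B" for m k
    using f[of k "x m"] B[OF x[of m]] by linarith
  then obtain c r where r: "strict_mono r" and c: "\<And>k. (\<lambda>m. f k (x (r m))) \<longlonglongrightarrow> c k"
    by (rule coordinatewise_convergent_subsequence[of "\<lambda>m k. f k (x m)" B]) blast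
  have cluster: "f k l = c k"
    if l: "\<And>U. openin weak_topology U \<Longrightarrow> l \<in> U \<Longrightarrow> infinite {m \<in> I. x (r m) \<in> U}" for l k I
  proof (rule ccontr)
    assume ne: "f k l \<noteq> c k"
    define d where "d = \<bar>f k l - c k\<bar> / 2"
    have d: "0 < d" using ne by (simp add: d_def)
    have "openin weak_topology (blinfun_apply (f k) -` ball (f k l) d)"
      by (intro openin_weak_vimage) simp
    then have "infinite {m \<in> I. x (r m) \<in> blinfun_apply (f k) -` ball (f k l) d}"
      by (rule l) (use d in simp)
    moreover obtain N where N: "\<And>m. N \<le> m \<Longrightarrow> \<bar>f k (x (r m)) - c k\<bar> < d"
      using LIMSEQ_D[OF c[of k] d] by auto
    ultimately obtain m where m: "N \<le> m" "x (r m) \<in> blinfun_apply (f k) -` ball (f k l) d"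
      unfolding infinite_nat_iff_unbounded_le by blast
    then have "\<bar>f k l - f k (x (r m))\<bar> < d"
      by (simp add: dist_real_def)
    then show False
      using N[OF m(1)] abs_triangle_ineq[of "f k l - f k (x (r m))" "f k (x (r m)) - c k"]
      by (simp add: d_def)
  qed
  obtain l where l: "l \<in> K"
    "\<And>U. openin weak_topology U \<Longrightarrow> l \<in> U \<Longrightarrow> infinite {m \<in> UNIV. x (r m) \<in> U}"
    by (rule compactin_cluster_point[OF K(1), of UNIV "\<lambda>m. x (r m)"]) (use x in auto)
  have "\<forall>\<^sub>F m in sequentially. x (r m) \<in> U" if U: "openin weak_topology U" "l \<in> U" for U
  proof (rule ccontr)
    assume "\<not> (\<forall>\<^sub>F m in sequentially. x (r m) \<in> U)"
    then have inf: "infinite {m. x (r m) \<notin> U}"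
      by (simp add: not_eventually frequently_sequentially infinite_nat_iff_unbounded_le)
    have "closedin weak_topology (UNIV - U)"
      using U(1) by (simp add: closedin_def double_diff)
    then have "compactin weak_topology (K \<inter> (UNIV - U))"
      using K(1) by (intro compact_Int_closedin)
    then obtain l' where l': "l' \<in> K \<inter> (UNIV - U)"
      "\<And>V. openin weak_topology V \<Longrightarrow> l' \<in> V \<Longrightarrow> infinite {m \<in> {m. x (r m) \<notin> U}. x (r m) \<in> V}"
      by (rule compactin_cluster_point[OF _ inf, of _ _ "\<lambda>m. x (r m)"]) (use x in auto)
    have "f k l = f k l'" for k
      using cluster[OF l(2)] cluster[OF l'(2)] by simp
    then have "l = l'"
      using l(1) l'(1) by (intro sep) auto
    then show False
      using l'(1) U(2) by simp
  qed
  then have "limitin weak_topology (\<lambda>m. x (r m)) l sequentially"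
    by (simp add: limitin_def)
  then show ?thesis
    using that l(1) r by blast
qed

text \<open>
  Norming functionals for the differences of points of \<open>D\<close> suffice: they have norm at most one, and
  every difference of points of the closure is close to one of these.
\<close>

lemma countable_separating_functionals:
  fixes D :: "'a::real_normed_vector set"
  assumes D: "countable D" "D \<noteq> {}"
  obtains f :: "nat \<Rightarrow> 'a \<Rightarrow>\<^sub>L real" where "\<And>k y. \<bar>f k y\<bar> \<le> norm y"
    "\<And>u v. u \<in> closure D \<Longrightarrow> v \<in> closure D \<Longrightarrow> (\<And>k. f k u = f k v) \<Longrightarrow> u = v"
proof -
  have "\<forall>z::'a. \<exists>g :: 'a \<Rightarrow>\<^sub>L real. (\<forall>y. \<bar>g y\<bar> \<le> norm y) \<and> norm z \<le> g z"
    using norming_functional by metis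
  then obtain g :: "'a \<Rightarrow> 'a \<Rightarrow>\<^sub>L real" where g: "\<And>z y. \<bar>g z y\<bar> \<le> norm y" "\<And>z. norm z \<le> g z z"
    by metis
  define f where "f k = (case from_nat_into (D \<times> D) k of (a, b) \<Rightarrow> g (a - b))" for k
  have "u = v" if uv: "u \<in> closure D" "v \<in> closure D" and eq: "\<And>k. f k u = f k v" for u v
  proof (rule ccontr)
    assume "u \<noteq> v"
    define d where "d = norm (u - v) / 8"
    have d: "0 < d" using \<open>u \<noteq> v\<close> by (simp add: d_def)
    obtain a b where ab: "a \<in> D" "dist a u < d" "b \<in> D" "dist b v < d"
      using uv d unfolding closure_approachable by metis
    have "countable (D \<times> D)" using D(1) by simp
    then obtain k where "from_nat_into (D \<times> D) k = (a, b)"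
      using from_nat_into_surj[of "D \<times> D" "(a, b)"] ab by auto
    then have k: "f k = g (a - b)" by (simp add: f_def)
    have "g (a - b) (a - b) = g (a - b) (a - u) - g (a - b) (b - v) + (g (a - b) u - g (a - b) v)"
      by (simp add: blinfun.diff_right)
    also have "\<dots> = g (a - b) (a - u) - g (a - b) (b - v)"
      using eq[of k] by (simp add: k)
    also have "\<dots> \<le> norm (a - u) + norm (b - v)"
      using g(1)[of "a - b" "a - u"] g(1)[of "a - b" "b - v"] by linarith
    finally have "norm (a - b) \<le> 2 * d"
      using g(2)[of "a - b"] ab by (simp add: dist_norm)
    moreover have "norm (u - v) \<le> norm (a - b) + norm (a - u) + norm (b - v)"
    proof -
      have "u - v = (a - b) - (a - u) + (b - v)" by simp
      then show ?thesis
        using norm_triangle_ineq[of "(a - b) - (a - u)" "b - v"] norm_triangle_ineq4[of "a - b" "a - u"]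
        by simp
    qed
    ultimately have "norm (u - v) \<le> 4 * d"
      using ab by (simp add: dist_norm)
    then show False
      using d by (simp add: d_def)
  qed
  moreover have "\<bar>f k y\<bar> \<le> norm y" for k y
    using g(1) by (simp add: f_def split: prod.split)
  ultimately show ?thesis
    using that by blast
qed

section \<open>Approximate fixed points\<close>

lemma weakly_seq_continuous_onD:
  assumes "weakly_seq_continuous_on M T" "limitin weak_topology x l sequentially"
    "\<And>n. x n \<in> M" "l \<in> M"
  shows "limitin weak_topology (\<lambda>n. T (x n)) (T l) sequentially"
  using assms(1)[unfolded weakly_seq_continuous_on_def, rule_format, of x l] assms(2-) by simp

text \<open>
  The argument of Schauder.  Choose an \<open>\<epsilon>\<close>-net \<open>a\<close> of \<open>K\<close> for the seminorm \<open>p\<close> and a partition of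
  unity \<open>lam\<close> subordinate to it.  The map that sends \<open>t\<close> to the numbers \<open>lam i (T (s t))\<close>, where
  \<open>s t\<close> is the point of \<open>K\<close> with barycentric coordinates \<open>t\<close>, takes a cube into itself and has a
  fixed point \<open>t\<close>; then \<open>s t\<close> is a convex combination of net points that are \<open>\<epsilon>\<close>-close to
  \<open>T (s t)\<close>.  The map \<open>s\<close> is continuous for the norm, so that weak sequential continuity of \<open>T\<close>
  suffices for the composition to be continuous on the cube.
\<close>

lemma weakly_approximate_fixed_point:
  fixes K :: "'a::real_normed_vector set" and f :: "nat \<Rightarrow> 'a \<Rightarrow>\<^sub>L real"
  assumes K: "convex K" "K \<noteq> {}" "compactin weak_topology K"
    and T: "T \<in> K \<rightarrow> K" "weakly_seq_continuous_on K T" and \<epsilon>: "0 < \<epsilon>"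
  obtains x where "x \<in> K" "(\<Sum>k<n. \<bar>f k (T x - x)\<bar>) \<le> \<epsilon>"
proof -
  define p where "p y = (\<Sum>k<n. \<bar>f k y\<bar>)" for y
  have p_lim: "((\<lambda>m. p (y m - a)) \<longlongrightarrow> p (l - a)) sequentially"
    if "limitin weak_topology y l sequentially" for y l a
    unfolding p_def blinfun.diff_right by (intro tendsto_intros limitin_weak_functional that)
  have p_open: "openin weak_topology {y. p (y - a) < \<epsilon>}" for a
  proof -
    have "continuous_map weak_topology euclidean (\<lambda>y. p (y - a))"
      unfolding p_def blinfun.diff_right
      by (intro continuous_intros continuous_map_weak_functional) auto
    then show ?thesis
      using openin_continuous_map_preimage[of weak_topology euclidean "\<lambda>y. p (y - a)" "{..<\<epsilon>}"] by simp
  qed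
  obtain A where A: "finite A" "A \<subseteq> K" "K \<subseteq> (\<Union>a\<in>A. {y. p (y - a) < \<epsilon>})"
  proof -
    have "(\<forall>V\<in>(\<lambda>a. {y. p (y - a) < \<epsilon>}) ` K. openin weak_topology V)
        \<and> K \<subseteq> \<Union>((\<lambda>a. {y. p (y - a) < \<epsilon>}) ` K)"
      using p_open \<epsilon> by (auto simp: p_def)
    then obtain \<F> where F: "finite \<F>" "\<F> \<subseteq> (\<lambda>a. {y. p (y - a) < \<epsilon>}) ` K" "K \<subseteq> \<Union>\<F>"
      using K(3) unfolding compactin_def by meson
    obtain A where "A \<subseteq> K" "finite A" "\<F> = (\<lambda>a. {y. p (y - a) < \<epsilon>}) ` A"
      using finite_subset_image[OF F(1,2)] by blast
    with F(3) show ?thesis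
      by (intro that[of A]) simp_all
  qed
  define N where "N = card A"
  obtain a where "bij_betw a {..<N} A"
    using ex_bij_betw_nat_finite[OF A(1)] unfolding N_def atLeast0LessThan by blast
  then have aA: "a ` {..<N} = A"
    by (simp add: bij_betw_def)
  then have aK: "a i \<in> K" if "i < N" for i
    using A(2) that by auto
  have net: "\<exists>i<N. p (y - a i) < \<epsilon>" if "y \<in> K" for y
    using A(3) that aA by auto
  have N0: "0 < N"
    using K(2) net by fastforce
  define \<mu> where "\<mu> i y = max 0 (\<epsilon> - p (y - a i))" for i y
  define \<sigma> where "\<sigma> y = (\<Sum>i<N. \<mu> i y)" for y
  define lam where "lam i y = \<mu> i y / \<sigma> y" for i y
  have \<mu>0: "0 \<le> \<mu> i y" for i y by (simp add: \<mu>_def)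
  have \<sigma>0: "0 < \<sigma> y" if y: "y \<in> K" for y
  proof -
    obtain i where "i < N" "p (y - a i) < \<epsilon>" using net[OF y] by blast
    then show ?thesis
      unfolding \<sigma>_def using \<mu>0 by (intro sum_pos2[of _ i]) (auto simp: \<mu>_def)
  qed
  have lam0: "0 \<le> lam i y" if "y \<in> K" for i y
    using \<mu>0 \<sigma>0[OF that] by (simp add: lam_def)
  have lam_sum: "(\<Sum>i<N. lam i y) = 1" if "y \<in> K" for y
    using \<sigma>0[OF that] by (simp add: lam_def sum_divide_distrib[symmetric] \<sigma>_def)
  have lam1: "lam i y \<le> 1" if "y \<in> K" "i < N" for i y
    using member_le_sum[of i "{..<N}" "\<lambda>i. lam i y"] lam0 lam_sum that by simp
  (* barycentric weights: on the cube, missing mass is put on the first net point and excess mass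
     is scaled away; on the standard simplex w t = t *)
  define w where "w t i = (t i + (if i = 0 then max 0 (1 - sum t {..<N}) else 0)) / max 1 (sum t {..<N})"
    for t :: "nat \<Rightarrow> real" and i
  define s where "s t = (\<Sum>i<N. w t i *\<^sub>R a i)" for t
  have sK: "s t \<in> K" if t: "\<forall>j<N. 0 \<le> t j \<and> t j \<le> 1" for t
    unfolding s_def
  proof (rule convex_sum)
    have "(\<Sum>i<N. t i + (if i = 0 then max 0 (1 - sum t {..<N}) else 0)) = max 1 (sum t {..<N})"
      using N0 by (simp add: sum.distrib sum.delta max_def)
    then show "(\<Sum>i<N. w t i) = 1"
      unfolding w_def sum_divide_distrib[symmetric] by simp
    show "0 \<le> w t i" if "i \<in> {..<N}" for i
      using t that by (simp add: w_def)
  qed (use K aK in auto)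
  have s_lim: "(\<lambda>m. s (u m)) \<longlonglongrightarrow> s t" if u: "\<And>j. j < N \<Longrightarrow> (\<lambda>m. u m j) \<longlonglongrightarrow> t j" for u t
  proof -
    have S: "(\<lambda>m. sum (u m) {..<N}) \<longlonglongrightarrow> sum t {..<N}"
      using u by (intro tendsto_sum) simp
    have "(\<lambda>m. w (u m) i) \<longlonglongrightarrow> w t i" if "i < N" for i
      unfolding w_def using that by (cases "i = 0") (auto intro!: tendsto_intros u S)
    then show ?thesis
      unfolding s_def by (intro tendsto_intros) auto
  qed
  obtain t where t: "\<And>i. i < N \<Longrightarrow> 0 \<le> t i \<and> t i \<le> 1" "\<And>i. i < N \<Longrightarrow> lam i (T (s t)) = t i"
  proof (rule brouwer_cube_nat[of N "\<lambda>t i. lam i (T (s t))"])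
    show "0 \<le> lam i (T (s t)) \<and> lam i (T (s t)) \<le> 1"
      if "\<And>j. j < N \<Longrightarrow> 0 \<le> t j \<and> t j \<le> 1" "i < N" for t i
    proof -
      have "s t \<in> K" using that(1) by (intro sK) blast
      then have "T (s t) \<in> K" using T(1) by blast
      then show ?thesis using lam0 lam1 that(2) by blast
    qed
    fix u t i
    assume u: "\<And>m j. j < N \<Longrightarrow> 0 \<le> u m j \<and> u m j \<le> (1::real)"
      and lim: "\<And>j. j < N \<Longrightarrow> (\<lambda>m. u m j) \<longlonglongrightarrow> t j" and i: "i < N"
    have t: "0 \<le> t j \<and> t j \<le> 1" if "j < N" for j
      using LIMSEQ_le_const[OF lim[OF that], of 0] LIMSEQ_le_const2[OF lim[OF that], of 1] u[OF that]
      by blast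
    have su: "s (u m) \<in> K" for m using u by (intro sK) blast
    have st: "s t \<in> K" using t by (intro sK) blast
    have "limitin weak_topology (\<lambda>m. s (u m)) (s t) sequentially"
      using s_lim[OF lim] by (rule tendsto_imp_limitin_weak)
    then have "limitin weak_topology (\<lambda>m. T (s (u m))) (T (s t)) sequentially"
      using su st by (rule weakly_seq_continuous_onD[OF T(2)])
    then have \<mu>: "(\<lambda>m. \<mu> i (T (s (u m)))) \<longlonglongrightarrow> \<mu> i (T (s t))" for i
      unfolding \<mu>_def by (intro tendsto_intros p_lim)
    have "\<sigma> (T (s t)) \<noteq> 0"
      using \<sigma>0[of "T (s t)"] st T(1) by force
    then show "(\<lambda>m. lam i (T (s (u m)))) \<longlonglongrightarrow> lam i (T (s t))"
      unfolding lam_def \<sigma>_def by (intro tendsto_intros \<mu>)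
  qed blast
  let ?x = "s t" and ?l = "\<lambda>i. lam i (T (s t))"
  have x: "?x \<in> K"
    using t(1) by (intro sK) blast
  then have Tx: "T ?x \<in> K"
    using T(1) by blast
  have "sum t {..<N} = (\<Sum>i<N. ?l i)"
    using t(2) by (intro sum.cong) auto
  then have "w t i = t i" for i
    by (simp add: w_def lam_sum[OF Tx])
  then have "(\<Sum>i<N. w t i *\<^sub>R a i) = (\<Sum>i<N. ?l i *\<^sub>R a i)"
    by (intro sum.cong) (simp_all add: t(2))
  then have s_eq: "?x = (\<Sum>i<N. ?l i *\<^sub>R a i)"
    using s_def[of t] by (rule trans[rotated])
  have "T ?x - ?x = (\<Sum>i<N. ?l i *\<^sub>R (T ?x - a i))"
    by (simp add: scaleR_diff_right sum_subtractf scaleR_sum_left[symmetric] lam_sum[OF Tx] s_eq[symmetric])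
  then have "p (T ?x - ?x) = (\<Sum>k<n. \<bar>\<Sum>i<N. ?l i * f k (T ?x - a i)\<bar>)"
    by (simp add: p_def blinfun.sum_right blinfun.scaleR_right)
  also have "\<dots> \<le> (\<Sum>k<n. \<Sum>i<N. ?l i * \<bar>f k (T ?x - a i)\<bar>)"
    using lam0[OF Tx] by (intro sum_mono order_trans[OF sum_abs]) (simp add: abs_mult)
  also have "\<dots> = (\<Sum>i<N. ?l i * p (T ?x - a i))"
    unfolding p_def by (subst sum.swap) (simp add: sum_distrib_left)
  also have "\<dots> \<le> (\<Sum>i<N. ?l i * \<epsilon>)"
  proof (rule sum_mono)
    fix i
    show "?l i * p (T ?x - a i) \<le> ?l i * \<epsilon>"
    proof (cases "p (T ?x - a i) \<le> \<epsilon>")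
      case True
      then show ?thesis using lam0[OF Tx] by (intro mult_left_mono)
    next
      case False
      then show ?thesis by (simp add: lam_def \<mu>_def)
    qed
  qed
  also have "\<dots> = \<epsilon>"
    by (simp add: sum_distrib_right[symmetric] lam_sum[OF Tx])
  finally show ?thesis
    using that x unfolding p_def by blast
qed

section \<open>The fixed point theorem\<close>

lemma weakly_seq_continuous_on_subset:
  "weakly_seq_continuous_on M T \<Longrightarrow> K \<subseteq> M \<Longrightarrow> weakly_seq_continuous_on K T"
  unfolding weakly_seq_continuous_on_def by blast

text \<open>
  The set \<open>D\<close> collects everything generated from \<open>x\<^sub>0\<close> by \<open>T\<close> and by convex combinations with
  rational weights.  Its closure is invariant although \<open>T\<close> need not be norm continuous: a norm
  limit of \<open>u m\<close> is mapped to the weak limit of \<open>T (u m)\<close>, which stays in the closed convex set.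
\<close>

lemma separable_invariant_convex_subset:
  fixes K :: "'a::real_normed_vector set"
  assumes K: "closed K" "convex K" "x\<^sub>0 \<in> K"
    and T: "T \<in> K \<rightarrow> K" "weakly_seq_continuous_on K T"
  obtains D where "countable D" "x\<^sub>0 \<in> D" "closure D \<subseteq> K" "convex (closure D)" "T ` closure D \<subseteq> closure D"
proof -
  let ?Q = "{0<..<1} \<inter> \<rat> :: real set"
  define step where
    "step E = E \<union> T ` E \<union> (\<lambda>(q, x, y). (1 - q) *\<^sub>R x + q *\<^sub>R y) ` (?Q \<times> E \<times> E)" for E
  define E where "E n = (step ^^ n) {x\<^sub>0}" for n
  have E0: "E 0 = {x\<^sub>0}" and ES: "E (Suc n) = step (E n)" for n
    by (simp_all add: E_def)
  define D where "D = (\<Union>n. E n)"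
  have inc: "E m \<subseteq> E n" if "m \<le> n" for m n
    using that by (rule lift_Suc_mono_le[rotated]) (auto simp: ES step_def)
  have "countable (E n)" for n
  proof (induction n)
    case (Suc n)
    have "countable ?Q" using countable_rat by (rule countable_subset[rotated]) auto
    with Suc show ?case by (simp add: ES step_def)
  qed (simp add: E0)
  then have cD: "countable D" by (simp add: D_def)
  have "E n \<subseteq> K" for n
  proof (induction n)
    case (Suc n)
    have "(1 - q) *\<^sub>R x + q *\<^sub>R y \<in> K" if "q \<in> ?Q" "x \<in> E n" "y \<in> E n" for q x y
      using that Suc by (intro convexD[OF K(2)]) auto
    moreover have "T ` E n \<subseteq> K"
      using Suc T(1) by blast
    ultimately show ?case
      using Suc by (auto simp: ES step_def)
  qed (simp add: E0 K)
  then have DK: "D \<subseteq> K" by (auto simp: D_def)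
  then have clK: "closure D \<subseteq> K"
    using K(1) by (rule closure_minimal)
  have TD: "T ` D \<subseteq> D"
  proof -
    have "T x \<in> E (Suc n)" if "x \<in> E n" for x n
      using that by (simp add: ES step_def)
    then show ?thesis by (auto simp: D_def)
  qed
  have comb: "(1 - q) *\<^sub>R x + q *\<^sub>R y \<in> D" if q: "q \<in> ?Q" and "x \<in> D" "y \<in> D" for q x y
  proof -
    obtain m n where "x \<in> E m" "y \<in> E n" using \<open>x \<in> D\<close> \<open>y \<in> D\<close> by (auto simp: D_def)
    then have "x \<in> E (max m n)" "y \<in> E (max m n)"
      using inc[of m "max m n"] inc[of n "max m n"] by auto
    then have "(q, x, y) \<in> ?Q \<times> E (max m n) \<times> E (max m n)" using q by blast
    then have "(1 - q) *\<^sub>R x + q *\<^sub>R y \<in> E (Suc (max m n))"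
      unfolding ES step_def by (intro UnI2 image_eqI[of _ _ "(q, x, y)"]) auto
    then show ?thesis by (auto simp: D_def)
  qed
  have "{0<..<1} \<subseteq> closure ?Q"
    using open_Int_closure_subset[of "{0<..<1::real}" "\<rat>"] by (simp add: Rats_closure_real)
  then have "closure {0<..<1::real} \<subseteq> closure ?Q"
    by (rule closure_minimal) simp
  then have Q: "{0..1} \<subseteq> closure ?Q" by simp
  have conv: "convex (closure D)"
  proof (rule convexI)
    fix x y :: 'a and u v :: real
    assume xy: "x \<in> closure D" "y \<in> closure D" and uv: "0 \<le> u" "0 \<le> v" "u + v = 1"
    let ?f = "\<lambda>(q::real, x, y). (1 - q) *\<^sub>R x + q *\<^sub>R y :: 'a"
    have "?f ` closure (?Q \<times> D \<times> D) \<subseteq> closure D"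
    proof (rule image_closure_subset)
      show "continuous_on (closure (?Q \<times> D \<times> D)) ?f"
        unfolding case_prod_beta by (intro continuous_intros)
      show "?f ` (?Q \<times> D \<times> D) \<subseteq> closure D"
        using comb closure_subset[of D] by fast
    qed simp
    moreover have "(v, x, y) \<in> closure (?Q \<times> D \<times> D)"
      unfolding closure_Times using Q uv xy by auto
    ultimately have "?f (v, x, y) \<in> closure D" by blast
    moreover have "1 - v = u" using uv by simp
    ultimately show "u *\<^sub>R x + v *\<^sub>R y \<in> closure D" by simp
  qed
  have "T u \<in> closure D" if u: "u \<in> closure D" for u
  proof -
    obtain v where v: "\<And>m. v m \<in> D" "v \<longlonglongrightarrow> u"
      using u unfolding closure_sequential by blast
    have "limitin weak_topology (\<lambda>m. T (v m)) (T u) sequentially"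
      by (rule weakly_seq_continuous_onD[OF T(2) tendsto_imp_limitin_weak[OF v(2)]])
         (use v(1) DK u clK in auto)
    moreover have "T (v m) \<in> closure D" for m
      using TD v(1) closure_subset[of D] by blast
    ultimately show ?thesis
      by (rule weak_limit_in_closed_convex[OF closed_closure conv])
  qed
  moreover have "x\<^sub>0 \<in> D" using E0 by (auto simp: D_def)
  ultimately show ?thesis
    using that cD clK conv by blast
qed

text \<open>
  A separable invariant subset \<open>C\<close> has a countable separating family \<open>f\<close>.  In \<open>C\<close>, points \<open>x n\<close> that
  are fixed by \<open>T\<close> up to \<open>1/(n+1)\<close> as seen by the first \<open>n\<close> functionals have a subsequence with a weak
  limit \<open>l\<close>.  Both \<open>x n\<close> and \<open>T (x n)\<close> converge weakly along it, so \<open>f k (T l) = f k l\<close> for all \<open>k\<close>.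
\<close>

theorem weakly_compact_fixed_point:
  fixes K :: "'a::real_normed_vector set"
  assumes K: "closed K" "convex K" "K \<noteq> {}" "bounded K" "compactin weak_topology K"
    and T: "T \<in> K \<rightarrow> K" "weakly_seq_continuous_on K T"
  shows "\<exists>y\<in>K. T y = y"
proof -
  obtain x\<^sub>0 where "x\<^sub>0 \<in> K" using K(3) by blast
  then obtain D where D: "countable D" "x\<^sub>0 \<in> D" "closure D \<subseteq> K" "convex (closure D)"
    "T ` closure D \<subseteq> closure D"
    using separable_invariant_convex_subset[OF K(1,2) _ T] by metis
  let ?C = "closure D"
  have "?C = K \<inter> ?C" using D(3) by blast
  then have C: "compactin weak_topology ?C"
    using compact_Int_closedin[OF K(5) mazur_closed_convex[OF closed_closure D(4)]] by simp
  have TC: "T \<in> ?C \<rightarrow> ?C" "weakly_seq_continuous_on ?C T"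
    using D(5) weakly_seq_continuous_on_subset[OF T(2) D(3)] by auto
  obtain f :: "nat \<Rightarrow> 'a \<Rightarrow>\<^sub>L real" where f: "\<And>k y. \<bar>f k y\<bar> \<le> norm y"
    and sep: "\<And>u v. u \<in> ?C \<Longrightarrow> v \<in> ?C \<Longrightarrow> (\<And>k. f k u = f k v) \<Longrightarrow> u = v"
    using countable_separating_functionals[OF D(1)] D(2) by blast
  have "\<exists>x. x \<in> ?C \<and> (\<Sum>k<n. \<bar>f k (T x - x)\<bar>) \<le> 1 / real (Suc n)" for n
    using weakly_approximate_fixed_point[OF D(4) _ C TC, of "1 / real (Suc n)" f n] D(2)
      closure_subset[of D] by (metis equals0D of_nat_0_less_iff subsetD zero_less_Suc zero_less_divide_1_iff)
  then obtain x where x: "\<And>n. x n \<in> ?C" "\<And>n. (\<Sum>k<n. \<bar>f k (T (x n) - x n)\<bar>) \<le> 1 / real (Suc n)"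
    by metis
  obtain l r where l: "l \<in> ?C" and r: "strict_mono r"
    and lim: "limitin weak_topology (\<lambda>m. x (r m)) l sequentially"
    by (rule weakly_convergent_subsequence[OF C bounded_subset[OF K(4) D(3)], of f x])
       (rule f, rule sep, assumption, assumption, blast, rule x(1), blast)
  have limT: "limitin weak_topology (\<lambda>m. T (x (r m))) (T l) sequentially"
    by (rule weakly_seq_continuous_onD[OF TC(2) lim]) (use x(1) l in auto)
  have "f k (T l) = f k l" for k
  proof -
    have lim1: "(\<lambda>m. f k (T (x (r m)) - x (r m))) \<longlonglongrightarrow> f k (T l) - f k l"
      unfolding blinfun.diff_right by (intro tendsto_intros limitin_weak_functional lim limT)
    have "\<bar>f k (T (x (r m)) - x (r m))\<bar> \<le> 1 / real (Suc m)" if m: "Suc k \<le> m" for m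
    proof -
      have rm: "m \<le> r m" using r by (rule seq_suble)
      have "\<bar>f k (T (x (r m)) - x (r m))\<bar> \<le> (\<Sum>k<r m. \<bar>f k (T (x (r m)) - x (r m))\<bar>)"
        using m rm by (intro member_le_sum) auto
      also have "\<dots> \<le> 1 / real (Suc (r m))" by (rule x(2))
      also have "\<dots> \<le> 1 / real (Suc m)" using rm by (intro divide_left_mono) auto
      finally show ?thesis .
    qed
    then have "\<forall>\<^sub>F m in sequentially. norm (f k (T (x (r m)) - x (r m))) \<le> 1 / real (Suc m)"
      unfolding eventually_sequentially real_norm_def by blast
    moreover have "(\<lambda>m. 1 / real (Suc m)) \<longlonglongrightarrow> 0"
      using LIMSEQ_inverse_real_of_nat by (simp add: inverse_eq_divide)
    ultimately have "(\<lambda>m. f k (T (x (r m)) - x (r m))) \<longlonglongrightarrow> 0"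
      by (rule Lim_null_comparison)
    then have "f k (T l) - f k l = 0"
      by (rule LIMSEQ_unique[OF lim1])
    then show ?thesis by simp
  qed
  then have "T l = l"
    using TC(1) l by (intro sep) auto
  then show ?thesis
    using l D(3) by blast
qed

theorem theorem3p1:
  fixes \<phi> :: "'a::banach \<Rightarrow>\<^sub>L 'a" and M :: "'a set" and T :: "'a \<Rightarrow> 'a"
  assumes "\<phi> \<notin> span {id_blinfun}"
    and "phi_space \<phi>"
    and "M \<noteq> {}" and "closed M" and "convex M" and "bounded M"
    and "T \<in> M \<rightarrow> M"
    and "weakly_seq_continuous_on M T"
    and "phi_condensing_on \<phi> M T"
  shows "\<exists>y\<in>M. T y = y"
proof -
  obtain x\<^sub>0 where x0: "x\<^sub>0 \<in> M" using \<open>M \<noteq> {}\<close> by blast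
  define \<K> where "\<K> = {K. closed K \<and> convex K \<and> x\<^sub>0 \<in> K \<and> T ` K \<subseteq> K \<and> K \<subseteq> M}"
  define K where "K = \<Inter>\<K>"
  have "M \<in> \<K>"
    using assms x0 by (auto simp: \<K>_def)
  then have KM: "K \<subseteq> M" by (auto simp: K_def)
  have K: "closed K" "convex K" "x\<^sub>0 \<in> K" "T ` K \<subseteq> K"
    unfolding K_def by (auto simp: \<K>_def intro!: closed_Inter convex_Inter)
  have bK: "bounded K" using \<open>bounded M\<close> KM by (rule bounded_subset)
  (* K is the smallest member of its family, hence generated by its own image and the base point *)
  let ?H = "closure (convex hull (insert x\<^sub>0 (T ` K)))"
  have HK: "?H \<subseteq> K"
    using K by (intro closure_minimal hull_minimal) auto
  have "T ` ?H \<subseteq> T ` K" using HK by (rule image_mono)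
  also have "\<dots> \<subseteq> ?H"
    using hull_subset[of "insert x\<^sub>0 (T ` K)" convex] closure_subset[of "convex hull (insert x\<^sub>0 (T ` K))"]
    by blast
  finally have "T ` ?H \<subseteq> ?H" .
  moreover have "x\<^sub>0 \<in> ?H"
    using hull_subset[of "insert x\<^sub>0 (T ` K)" convex] closure_subset[of "convex hull (insert x\<^sub>0 (T ` K))"]
    by blast
  ultimately have "?H \<in> \<K>"
    using HK KM by (auto simp: \<K>_def convex_closure)
  then have KH: "K \<subseteq> ?H" by (auto simp: K_def)
  have bTK: "bounded (T ` K)" using bK K(4) by (rule bounded_subset)
  have bphi: "bounded (\<phi> ` S)" if "bounded S" for S
    using that blinfun.bounded_linear_right by (rule bounded_linear_image)
  have "\<phi> ` K \<subseteq> \<phi> ` ?H" using KH by (rule image_mono)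
  also have "\<dots> \<subseteq> closure (\<phi> ` (convex hull (insert x\<^sub>0 (T ` K))))"
    by (rule closure_bounded_linear_image_subset[OF blinfun.bounded_linear_right])
  also have "\<phi> ` (convex hull (insert x\<^sub>0 (T ` K))) = convex hull (insert (\<phi> x\<^sub>0) (\<phi> ` T ` K))"
    using convex_hull_linear_image[OF bounded_linear.linear[OF blinfun.bounded_linear_right], of \<phi> "insert x\<^sub>0 (T ` K)"]
    by simp
  finally have "phi_mnc \<phi> K \<le> phi_mnc \<phi> (T ` K)"
    unfolding phi_mnc_def by (rule kuratowski_mnc_closure_convex_hull_le[OF bphi[OF bTK]])
  moreover have "phi_mnc \<phi> (T ` K) < phi_mnc \<phi> K" if "0 < phi_mnc \<phi> K"
    using \<open>phi_condensing_on \<phi> M T\<close> bK KM K(3) that unfolding phi_condensing_on_def by blast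
  ultimately have "phi_mnc \<phi> K \<le> 0"
    by linarith
  then have "compact (closure (\<phi> ` K))"
    unfolding phi_mnc_def by (rule kuratowski_mnc_zero_imp_compact_closure[OF bphi[OF bK]])
  then have "compactin weak_topology K"
    using \<open>phi_space \<phi>\<close> bK mazur_closed_convex[OF K(1,2)] unfolding phi_space_def by blast
  then have "\<exists>y\<in>K. T y = y"
    using K bK weakly_seq_continuous_on_subset[OF \<open>weakly_seq_continuous_on M T\<close> KM]
    by (intro weakly_compact_fixed_point) auto
  then show ?thesis
    using KM by blast
qed

end
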